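(* Let $f\in\mathcal{S}^{*}_{\mathcal{B}}$. Then $|H_4(1)|\leq 0.169251$.
   Context: Let $\mathbb{D}=\{z\in\mathbb{C}:|z|<1\}$. Let $\mathcal{A}$ be the class of analytic functions $f$ on $\mathbb{D}$ of the form $f(z)=z+\sum_{n=2}^{\infty}a_nz^n$. For analytic functions $h,g$ on $\mathbb{D}$, $h\prec g$ ($h$ is subordinate to $g$) means that there is an analytic function $w$ on $\mathbb{D}$ with $w(0)=0$ and $|w(z)|\le |z|$ (a Schwarz function) such that $h(z)=g(w(z))$ for $z \in \mathbb{D}$. The class $\mathcal{S}^{*}_{\mathcal{B}}$ is $$\mathcal{S}^{*}_{\mathcal{B}}=\left\{f\in\mathcal{A}:\ \frac{zf'(z)}{f(z)}\prec\sqrt{1+\tanh z}\right\},$$ where the branch of the square root is the one with value $1$ at $z=0$. For $f(z)=z+\sum_{n=2}^{\infty}a_nz^n\in\mathcal{A}$ with $a_1:=1$, the Hankel determinant $H_q(n)$ ($q,n\in\mathbb{N}$) is the determinant of the $q\times q$ matrix whose $(i,j)$ entry is $a_{n+i+j-2}$, $1\le i,j\le q$. In particular, $H_4(1)$ is the determinant of the $4\times 4$ matrix with $(i,j)$ entry $a_{i+j-1}$. *)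

theory Defs
  imports "HOL-Complex_Analysis.Complex_Analysis" "Jordan_Normal_Form.Determinant"
begin

text \<open>The unit disk \<open>\<D>\<close> is \<^term>\<open>ball (0::complex) 1\<close>.\<close>

definition class_A :: "(complex \<Rightarrow> complex) set" where
  "class_A = {f. f holomorphic_on ball 0 1 \<and> f 0 = 0 \<and> deriv f 0 = 1}"

definition taylor_coeff :: "(complex \<Rightarrow> complex) \<Rightarrow> nat \<Rightarrow> complex" where
  "taylor_coeff f n = (deriv ^^ n) f 0 / fact n"

definition subordinate :: "(complex \<Rightarrow> complex) \<Rightarrow> (complex \<Rightarrow> complex) \<Rightarrow> bool" where
  "subordinate h g \<longleftrightarrow>
     h holomorphic_on ball 0 1 \<and> g holomorphic_on ball 0 1 \<and>
     (\<exists>w. w holomorphic_on ball 0 1 \<and> w 0 = 0 \<and>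
          (\<forall>z\<in>ball 0 1. norm (w z) \<le> norm z) \<and>
          (\<forall>z\<in>ball 0 1. h z = g (w z)))"

text \<open>
  For \<open>f \<in> \<A>\<close> the quotient \<open>z f'(z) / f(z)\<close> has a removable singularity at \<open>0\<close>, where its
  value is \<open>1\<close>; with the convention \<open>x / 0 = 0\<close> this value has to be given explicitly.
\<close>
definition log_deriv_quot :: "(complex \<Rightarrow> complex) \<Rightarrow> complex \<Rightarrow> complex" where
  "log_deriv_quot f z = (if z = 0 then 1 else z * deriv f z / f z)"

text \<open>
  The condition \<open>f z \<noteq> 0\<close> says that \<open>z f'(z) / f(z)\<close> is a genuine quotient off the origin. The
  principal branch \<^const>\<open>csqrt\<close> is the required branch of the square root, by the two lemmas
  that follow.
\<close>
definition class_S_star_B :: "(complex \<Rightarrow> complex) set" where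
  "class_S_star_B =
     {f \<in> class_A. (\<forall>z \<in> ball 0 1 - {0}. f z \<noteq> 0) \<and>
                   subordinate (log_deriv_quot f) (\<lambda>z. csqrt (1 + tanh z))}"

lemma csqrt_one_plus_tanh_0: "csqrt (1 + tanh 0) = 1"
  by simp

lemma holomorphic_csqrt_one_plus_tanh:
  "(\<lambda>z. csqrt (1 + tanh z)) holomorphic_on ball 0 1"
proof -
  have im: "\<bar>Im z\<bar> < pi / 2" if "z \<in> ball 0 1" for z :: complex
    using that abs_Im_le_cmod[of z] pi_gt3 by simp
  have cosh: "cosh z \<noteq> 0" and sqr: "1 + tanh z \<notin> \<real>\<^sub>\<le>\<^sub>0"
    if z: "z \<in> ball 0 1" for z :: complex
  proof -
    define u where "u = exp (- (2 * z))"
    have u_notin: "1 + u \<notin> \<real>\<^sub>\<le>\<^sub>0"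
    proof
      assume "1 + u \<in> \<real>\<^sub>\<le>\<^sub>0"
      then have re: "Re u < 0" and "Im u = 0"
        by (auto simp: complex_nonpos_Reals_iff)
      then have "sin (2 * Im z) = 0"
        by (simp add: u_def Im_exp)
      moreover have "\<bar>2 * Im z\<bar> < pi"
        using im[OF z] by simp
      ultimately have "Im z = 0"
        by (metis abs_less_iff sin_eq_0_pi minus_less_iff mult_eq_0_iff zero_neq_numeral)
      with re show False
        by (simp add: u_def Re_exp)
    qed
    then have nz: "1 + u \<noteq> 0"
      by auto
    have e: "cosh z = exp z * (1 + u) / 2" "sinh z = exp z * (1 - u) / 2"
      by (simp_all add: u_def cosh_field_def sinh_field_def ring_distribs flip: exp_add)
    show "cosh z \<noteq> 0"
      using nz by (simp add: e)
    have "tanh z = (1 - u) / (1 + u)"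
      by (simp add: tanh_def e)
    then have eq: "1 + tanh z = 2 / (1 + u)"
      using nz by (simp add: add_divide_eq_iff)
    have "1 + u = 2 / (1 + tanh z)"
      using nz by (simp add: eq)
    with u_notin show "1 + tanh z \<notin> \<real>\<^sub>\<le>\<^sub>0"
      using nonpos_Reals_divide_I1[of 2 "1 + tanh z"] by auto
  qed
  have "(\<lambda>z. tanh z :: complex) holomorphic_on ball 0 1"
    using cosh unfolding tanh_def sinh_field_def cosh_field_def
    by (intro holomorphic_intros) auto
  then show ?thesis
    using sqr by (intro holomorphic_intros)
qed

text \<open>
  The entry \<open>a\<^bsub>n+i+j-2\<^esub>\<close> with \<open>1 \<le> i, j \<le> q\<close> is \<open>a\<^bsub>n+i+j\<^esub>\<close> in the zero-based indexing of
  matrices used here.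
\<close>
definition hankel_det :: "nat \<Rightarrow> nat \<Rightarrow> (complex \<Rightarrow> complex) \<Rightarrow> complex" where
  "hankel_det q n f = Determinant.det (Matrix.mat q q (\<lambda>(i, j). taylor_coeff f (n + i + j)))"

end

theory Submission
  imports Defs
begin

text \<open>
  Write \<open>z f'(z) / f(z) = \<phi> (w z)\<close> with \<open>\<phi> = sqrt (1 + tanh)\<close>, and let \<open>h\<^sub>k\<close> be the coefficients of
  this function. By Rogosinski's theorem \<open>\<Sum>k\<le>6. \<bar>h\<^sub>k\<bar>\<^sup>2\<close> is at most the same sum for \<open>\<phi>\<close>, which the
  equation \<open>\<phi>' = \<phi> - \<phi>\<^sup>3 / 2\<close> shows to be less than \<open>1.28\<close>. The recurrence
  \<open>(n - 1) a\<^sub>n = \<Sum>k=1..n-1. h\<^sub>k a\<^bsub>n-k\<^esub>\<close> and the Cauchy-Schwarz inequality then bound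
  \<open>\<bar>a\<^sub>2\<bar>, \<dots>, \<bar>a\<^sub>7\<bar>\<close> so well that the triangle inequality applied to the Laplace expansion of the
  Hankel determinant suffices.
\<close>

section \<open>Taylor coefficients as coefficients of formal power series\<close>

lemma taylor_coeff_eq_fps_nth: "taylor_coeff f n = fps_nth (fps_expansion f 0) n"
  by (simp add: taylor_coeff_def fps_expansion_def)

lemma taylor_coeff_eqI: "f has_fps_expansion F \<Longrightarrow> taylor_coeff f n = fps_nth F n"
  by (metis fps_expansion_eqI taylor_coeff_eq_fps_nth)

lemma has_fps_expansion_ball:
  "f holomorphic_on ball 0 1 \<Longrightarrow> f has_fps_expansion fps_expansion f 0"
  by (rule has_fps_expansion_fps_expansion[of "ball 0 1"]) auto

section \<open>Mean squares over circles and Rogosinski's inequality\<close>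

definition circ :: "real \<Rightarrow> real \<Rightarrow> complex" where
  "circ r t = of_real r * exp (2 * of_real pi * \<i> * of_real t)"

lemma norm_circ: "0 \<le> r \<Longrightarrow> norm (circ r t) = r"
  by (simp add: circ_def norm_mult)

lemma continuous_on_circ [continuous_intros]: "continuous_on A (circ r)"
  unfolding circ_def by (intro continuous_intros)

lemma continuous_on_compose_circ:
  assumes "g holomorphic_on ball 0 1" "0 < r" "r < 1"
  shows "continuous_on A (\<lambda>t. g (circ r t))"
  using assms
  by (intro continuous_on_compose2[OF holomorphic_on_imp_continuous_on[OF assms(1)]]
      continuous_intros) (auto simp: norm_circ)

text \<open>The mean value property, from Cauchy's formula on \<open>circlepath 0 r\<close>: the
  derivative of the path is 2 pi i times the point itself, which cancels the Cauchy kernel.\<close>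

lemma has_integral_circ:
  assumes g: "g holomorphic_on ball 0 1" and r: "0 < r" "r < 1"
  shows "((\<lambda>t. g (circ r t)) has_integral g 0) {0..1}"
proof -
  have "g holomorphic_on cball 0 r"
    using g by (rule holomorphic_on_subset) (use r in auto)
  then have int: "((\<lambda>u. g u / (u - 0)) has_contour_integral 2 * of_real pi * \<i> * g 0) (circlepath 0 r)"
    using r by (intro Cauchy_integral_circlepath_simple) auto
  have c: "circlepath 0 r t = circ r t" for t
    by (simp add: circlepath circ_def)
  have "((\<lambda>t. (g (circ r t) / circ r t) * (2 * of_real pi * \<i> * circ r t))
      has_integral 2 * of_real pi * \<i> * g 0) {0..1}"
    using int unfolding has_contour_integral_def
    by (rule has_integral_eq[rotated])
       (simp add: c vector_derivative_circlepath01, simp add: circ_def)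
  then have "((\<lambda>t. 2 * of_real pi * \<i> * g (circ r t)) has_integral 2 * of_real pi * \<i> * g 0) {0..1}"
    by (rule has_integral_eq[rotated]) (use r in \<open>auto simp: circ_def\<close>)
  from has_integral_mult_right[OF this, of "1 / (2 * of_real pi * \<i>)"] show ?thesis
    by (simp add: field_simps)
qed

definition circ_mean :: "real \<Rightarrow> (complex \<Rightarrow> complex) \<Rightarrow> real" where
  "circ_mean r g = integral {0..1} (\<lambda>t. (norm (g (circ r t)))\<^sup>2)"

lemma integrable_circ_mean:
  assumes "g holomorphic_on ball 0 1" "0 < r" "r < 1"
  shows "(\<lambda>t. (norm (g (circ r t)))\<^sup>2) integrable_on {0..1}"
  by (intro integrable_continuous_real continuous_intros continuous_on_compose_circ assms)

lemma circ_mean_nonneg: "0 \<le> circ_mean r g"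
  \<comment> \<open>A non-integrable function has integral 0 by convention.\<close>
  unfolding circ_mean_def by (cases "(\<lambda>t. (norm (g (circ r t)))\<^sup>2) integrable_on {0..1}")
     (auto intro: integral_nonneg simp: not_integrable_integral)

text \<open>Constants are orthogonal to functions vanishing at 0: by the mean value property the
  cross term \<open>2 * Re (cnj c * u)\<close> has mean 0.\<close>

lemma circ_mean_const_plus:
  assumes u: "u holomorphic_on ball 0 1" "u 0 = 0" and r: "0 < r" "r < 1"
  shows "circ_mean r (\<lambda>z. c + u z) = (norm c)\<^sup>2 + circ_mean r u"
proof -
  have 1: "((\<lambda>t. (norm (u (circ r t)))\<^sup>2) has_integral circ_mean r u) {0..1}"
    unfolding circ_mean_def by (intro integrable_integral integrable_circ_mean u r)
  have "((\<lambda>t. cnj c * u (circ r t)) has_integral cnj c * u 0) {0..1}"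
    by (intro has_integral_mult_right has_integral_circ u r)
  from has_integral_linear[OF this bounded_linear_Re] u
  have 2: "((\<lambda>t. Re (cnj c * u (circ r t))) has_integral 0) {0..1}"
    by (simp add: o_def)
  have 3: "((\<lambda>t::real. (norm c)\<^sup>2) has_integral (norm c)\<^sup>2) {0..1}"
    using has_integral_const_real[of "(norm c)\<^sup>2" 0 1] by simp
  have eq: "(norm (c + v))\<^sup>2 = (norm c)\<^sup>2 + (norm v)\<^sup>2 + 2 * Re (cnj c * v)" for v
    by (simp only: cmod_power2) (simp add: power2_eq_square algebra_simps)
  have "((\<lambda>t. (norm c)\<^sup>2 + (norm (u (circ r t)))\<^sup>2 + 2 * Re (cnj c * u (circ r t)))
      has_integral (norm c)\<^sup>2 + circ_mean r u + 2 * 0) {0..1}"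
    by (intro has_integral_add 1 3 has_integral_mult_right 2)
  then show ?thesis
    unfolding circ_mean_def eq by (simp add: integral_unique)
qed

text \<open>Induction along Horner's scheme: in \<open>c 0 + w * Q\<close> the constant splits off
  because \<open>w 0 = 0\<close>, and the factor \<open>w\<close>, of modulus at most 1, can then be
  dropped.\<close>

lemma circ_mean_poly_Schwarz_le:
  assumes w: "w holomorphic_on ball 0 1" "w 0 = 0" "\<And>z. norm z < 1 \<Longrightarrow> norm (w z) \<le> norm z"
    and r: "0 < r" "r < 1"
  shows "circ_mean r (\<lambda>z. \<Sum>j<n. c j * w z ^ j) \<le> (\<Sum>j<n. (norm (c j))\<^sup>2)"
proof (induction n arbitrary: c)
  case 0
  then show ?case by (simp add: circ_mean_def)
next
  case (Suc n)
  let ?Q = "\<lambda>z. \<Sum>j<n. c (Suc j) * w z ^ j"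
  have Q: "?Q holomorphic_on ball 0 1"
    by (intro holomorphic_intros w)
  have "circ_mean r (\<lambda>z. \<Sum>j<Suc n. c j * w z ^ j) = circ_mean r (\<lambda>z. c 0 + w z * ?Q z)"
    unfolding sum.lessThan_Suc_shift by (simp add: sum_distrib_left mult_ac)
  also have "\<dots> = (norm (c 0))\<^sup>2 + circ_mean r (\<lambda>z. w z * ?Q z)"
    using w r by (intro circ_mean_const_plus holomorphic_intros) auto
  also have "circ_mean r (\<lambda>z. w z * ?Q z) \<le> circ_mean r ?Q"
    unfolding circ_mean_def
  proof (intro integral_le integrable_circ_mean r holomorphic_intros w)
    fix t :: real assume "t \<in> {0..1}"
    have "norm (w (circ r t)) \<le> 1"
      using w(3)[of "circ r t"] r by (simp add: norm_circ)
    then show "(norm (w (circ r t) * ?Q (circ r t)))\<^sup>2 \<le> (norm (?Q (circ r t)))\<^sup>2"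
      by (intro power_mono) (auto simp: norm_mult intro: mult_left_le_one_le)
  qed
  also have "\<dots> \<le> (\<Sum>j<n. (norm (c (Suc j)))\<^sup>2)"
    by (rule Suc.IH)
  also have "(norm (c 0))\<^sup>2 + (\<Sum>j<n. (norm (c (Suc j)))\<^sup>2) = (\<Sum>j<Suc n. (norm (c j))\<^sup>2)"
    by (rule sum.lessThan_Suc_shift[symmetric])
  finally show ?case by simp
qed

text \<open>The same peeling of constants with z in place of w: in g = g(0) + z H the factor z has
  modulus exactly \<open>r\<close> on the circle, which produces the powers of
  \<open>r\<close>.\<close>

lemma Bessel_circ_mean:
  assumes "g holomorphic_on ball 0 1" and r: "0 < r" "r < 1"
  shows "(\<Sum>k<n. (norm (taylor_coeff g k))\<^sup>2 * r ^ (2 * k)) \<le> circ_mean r g"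
  using assms(1)
proof (induction n arbitrary: g)
  case 0
  then show ?case by (simp add: circ_mean_nonneg)
next
  case (Suc n)
  \<comment> \<open>The difference quotient with its removable singularity filled in; its Taylor
    coefficients are those of \<open>g\<close> shifted by one place.\<close>
  define H where "H = (\<lambda>z. if z = 0 then deriv g 0 else (g z - g 0) / (z - 0))"
  have H: "H holomorphic_on ball 0 1"
    unfolding H_def using Suc.prems by (intro pole_lemma_open) auto
  have g: "g = (\<lambda>z. g 0 + z * H z)"
    by (auto simp: H_def)
  have "(\<lambda>z. g 0 + z * H z) has_fps_expansion fps_const (g 0) + fps_X * fps_expansion H 0"
    by (intro fps_expansion_intros has_fps_expansion_ball H)
  then have G: "g has_fps_expansion fps_const (g 0) + fps_X * fps_expansion H 0"
    using g by simp
  have 0: "taylor_coeff g 0 = g 0" and S: "taylor_coeff g (Suc k) = taylor_coeff H k" for k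
    unfolding taylor_coeff_eqI[OF G] by (simp_all add: taylor_coeff_eq_fps_nth)
  have "(\<Sum>k<Suc n. (norm (taylor_coeff g k))\<^sup>2 * r ^ (2 * k)) =
      (norm (g 0))\<^sup>2 + r\<^sup>2 * (\<Sum>k<n. (norm (taylor_coeff H k))\<^sup>2 * r ^ (2 * k))"
    unfolding sum.lessThan_Suc_shift
    by (simp add: 0 S sum_distrib_left mult_ac power2_eq_square)
  also have "\<dots> \<le> (norm (g 0))\<^sup>2 + r\<^sup>2 * circ_mean r H"
    using Suc.IH[OF H] by (intro add_left_mono mult_left_mono) auto
  also have "r\<^sup>2 * circ_mean r H = circ_mean r (\<lambda>z. z * H z)"
    unfolding circ_mean_def using r by (simp add: norm_mult norm_circ power_mult_distrib)
  also have "(norm (g 0))\<^sup>2 + \<dots> = circ_mean r g"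
  proof -
    have "circ_mean r g = circ_mean r (\<lambda>z. g 0 + z * H z)"
      by (rule arg_cong[OF g])
    also have "\<dots> = (norm (g 0))\<^sup>2 + circ_mean r (\<lambda>z. z * H z)"
      using H r by (intro circ_mean_const_plus holomorphic_intros) auto
    finally show ?thesis ..
  qed
  finally show ?case .
qed

text \<open>Rogosinski's theorem, by Littlewood's argument: the powers of \<open>w\<close> need not be orthogonal,
  but each splitting off of a constant term is, and multiplication by \<open>w\<close> is a contraction.\<close>
theorem Rogosinski:
  assumes g: "g holomorphic_on ball 0 1"
    and w: "w holomorphic_on ball 0 1" "w 0 = 0" "\<And>z. norm z < 1 \<Longrightarrow> norm (w z) \<le> norm z"
  shows "(\<Sum>k<n. (norm (taylor_coeff (\<lambda>z. g (w z)) k))\<^sup>2) \<le> (\<Sum>k<n. (norm (taylor_coeff g k))\<^sup>2)"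
proof -
  define P where "P = (\<lambda>z. \<Sum>j<n. taylor_coeff g j * w z ^ j)"
  define W where "W = fps_expansion w 0"
  have W: "w has_fps_expansion W"
    unfolding W_def by (intro has_fps_expansion_ball w)
  have W0: "fps_nth W 0 = 0"
    using w by (simp add: W_def fps_expansion_def)
  have hP: "P holomorphic_on ball 0 1"
    unfolding P_def by (intro holomorphic_intros w)
  have "(\<lambda>z. g (w z)) has_fps_expansion (fps_expansion g 0 oo W)"
    using has_fps_expansion_compose[OF has_fps_expansion_ball[OF g] W W0] by (simp add: o_def)
  note gw = taylor_coeff_eqI[OF this]
  have "P has_fps_expansion (\<Sum>j<n. fps_const (taylor_coeff g j) * W ^ j)"
    unfolding P_def by (intro fps_expansion_intros W)
  note P = taylor_coeff_eqI[OF this]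
  \<comment> \<open>Truncating \<open>g\<close> at degree \<open>n\<close> changes nothing below
    order \<open>n\<close>: \<open>W ^ j\<close> has no coefficient below \<open>j\<close>, so only
    \<open>j \<le> k\<close> contributes to coefficient \<open>k\<close>.\<close>
  have coeff: "taylor_coeff P k = taylor_coeff (\<lambda>z. g (w z)) k" if "k < n" for k
  proof -
    have "taylor_coeff P k = (\<Sum>j<n. taylor_coeff g j * fps_nth (W ^ j) k)"
      by (simp add: P fps_sum_nth)
    also have "\<dots> = (\<Sum>j=0..k. taylor_coeff g j * fps_nth (W ^ j) k)"
      using that W0
      by (intro sum.mono_neutral_right) (auto simp: startsby_zero_power_prefix)
    finally show ?thesis
      by (simp add: gw fps_compose_nth taylor_coeff_eq_fps_nth)
  qed
  let ?L = "\<lambda>r. \<Sum>k<n. (norm (taylor_coeff (\<lambda>z. g (w z)) k))\<^sup>2 * r ^ (2 * k)"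
  have le: "?L r \<le> (\<Sum>k<n. (norm (taylor_coeff g k))\<^sup>2)" if "0 < r" "r < 1" for r
  proof -
    have "?L r = (\<Sum>k<n. (norm (taylor_coeff P k))\<^sup>2 * r ^ (2 * k))"
      by (simp add: coeff)
    also have "\<dots> \<le> circ_mean r P"
      by (rule Bessel_circ_mean[OF hP that])
    also have "\<dots> \<le> (\<Sum>k<n. (norm (taylor_coeff g k))\<^sup>2)"
      unfolding P_def by (rule circ_mean_poly_Schwarz_le[OF w that])
    finally show ?thesis .
  qed
  \<comment> \<open>The upper bound is independent of \<open>r\<close> and the left side is a
    polynomial in \<open>r\<close>, so letting \<open>r\<close> tend to 1 removes the
    weights.\<close>
  have "(?L \<longlongrightarrow> ?L 1) (at_left 1)"
    by (intro tendsto_intros)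
  moreover have "\<forall>\<^sub>F r in at_left (1::real). ?L r \<le> (\<Sum>k<n. (norm (taylor_coeff g k))\<^sup>2)"
    by (rule eventually_mono[OF eventually_at_left_real[of 0]]) (auto intro: le)
  ultimately have "?L 1 \<le> (\<Sum>k<n. (norm (taylor_coeff g k))\<^sup>2)"
    by (intro tendsto_upperbound) auto
  then show ?thesis by simp
qed

section \<open>Taylor coefficients of sqrt(1 + tanh) at 0\<close>

text \<open>By the chain rule \<open>poly p (f z)\<close> has derivative
  \<open>poly (pderiv p * q) (f z)\<close>; iterating from the identity polynomial reduces higher
  derivatives to polynomial arithmetic.\<close>

lemma higher_deriv_autonomous:
  fixes f :: "complex \<Rightarrow> complex"
  assumes S: "open S"
    and f: "\<And>z. z \<in> S \<Longrightarrow> (f has_field_derivative poly q (f z)) (at z)"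
    and "z \<in> S"
  shows "(deriv ^^ n) f z = poly (((\<lambda>p. pderiv p * q) ^^ n) [:0, 1:]) (f z)"
  using \<open>z \<in> S\<close>
proof (induction n arbitrary: z)
  case 0
  then show ?case by simp
next
  case (Suc n)
  let ?p = "((\<lambda>p. pderiv p * q) ^^ n) [:0, 1:]"
  have "((\<lambda>z. poly ?p (f z)) has_field_derivative poly (pderiv ?p) (f z) * poly q (f z)) (at z)"
    by (rule DERIV_chain'[OF f poly_DERIV]) (rule Suc.prems)
  then have "((deriv ^^ n) f has_field_derivative poly (pderiv ?p) (f z) * poly q (f z)) (at z)"
    by (rule has_field_derivative_transform_within_open[OF _ S Suc.prems]) (rule Suc.IH[symmetric])
  then show ?case
    by (simp add: DERIV_imp_deriv)
qed

text \<open>Differentiating \<phi>^2 = 1 + tanh gives 2 \<phi> \<phi>' = 1 - tanh^2 = 1 - (\<phi>^2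
  - 1)^2, and 2 \<phi> cancels since \<phi> has no zero in the disk.\<close>

lemma deriv_csqrt_one_plus_tanh:
  assumes z: "z \<in> ball 0 1"
  defines "\<phi> \<equiv> \<lambda>z::complex. csqrt (1 + tanh z)"
  shows "(\<phi> has_field_derivative poly [:0, 1, 0, - 1 / 2:] (\<phi> z)) (at z)"
proof -
  have "\<bar>Im z\<bar> < pi / 2"
    using z abs_Im_le_cmod[of z] pi_gt3 by simp
  then have "cos (Im z) > 0"
    by (intro cos_gt_zero_pi) auto
  \<comment> \<open>The real part of cosh z is cosh(Re z) cos(Im z).\<close>
  then have "Re (cosh z) \<noteq> 0"
    by (simp add: cosh_conv_cos Re_cos add_pos_pos less_imp_neq[symmetric])
  then have cosh: "cosh z \<noteq> 0"
    by auto
  have "\<phi> z \<noteq> 0"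
  proof
    assume "\<phi> z = 0"
    then have "tanh z = -1"
      by (simp add: \<phi>_def add_eq_0_iff)
    then have "cosh z + sinh z = 0"
      using cosh by (simp add: tanh_def divide_eq_eq)
    then show False
      by (simp add: cosh_plus_sinh)
  qed
  have sq: "(\<phi> y)\<^sup>2 = 1 + tanh y" for y
    by (simp add: \<phi>_def)
  obtain d where d: "(\<phi> has_field_derivative d) (at z)"
    using holomorphic_csqrt_one_plus_tanh z
    unfolding holomorphic_on_open[OF open_ball] \<phi>_def by blast
  have "((\<lambda>y. (\<phi> y)\<^sup>2) has_field_derivative 2 * \<phi> z * d) (at z)"
    by (auto intro!: derivative_eq_intros d)
  moreover have "((\<lambda>y. (\<phi> y)\<^sup>2) has_field_derivative 1 - (tanh z)\<^sup>2) (at z)"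
    unfolding sq using cosh by (auto intro!: derivative_eq_intros)
  ultimately have "2 * \<phi> z * d = 1 - (tanh z)\<^sup>2"
    by (rule DERIV_unique)
  also have "tanh z = (\<phi> z)\<^sup>2 - 1"
    by (simp add: sq)
  also have "1 - ((\<phi> z)\<^sup>2 - 1)\<^sup>2 = 2 * \<phi> z * (\<phi> z - (\<phi> z) ^ 3 / 2)"
    by (simp add: power2_eq_square power3_eq_cube algebra_simps)
  finally have "d = \<phi> z - (\<phi> z) ^ 3 / 2"
    using \<open>\<phi> z \<noteq> 0\<close> by simp
  then show ?thesis
    using d by (simp add: power3_eq_cube right_diff_distrib mult.assoc)
qed

text \<open>The squares of coefficients 1 to 6 add up to about 0.27967, rounded up to 7/25. Order 6
  suffices because the last Hankel entry, the seventh coefficient of f, involves only these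
  orders.\<close>

lemma sum_norm_taylor_coeff_csqrt_one_plus_tanh:
  "(\<Sum>k<7. (norm (taylor_coeff (\<lambda>z. csqrt (1 + tanh z)) k))\<^sup>2) \<le> 1 + 7 / 25"
proof -
  let ?\<phi> = "\<lambda>z::complex. csqrt (1 + tanh z)"
  \<comment> \<open>\<open>Q n\<close> expresses the n-th derivative as a polynomial in the
    function, whose value at 0 is 1.\<close>
  define Q where "Q = (\<lambda>n. ((\<lambda>p. pderiv p * [:0, 1, 0, - 1 / 2:]) ^^ n) [:0, 1::complex:])"
  have d: "(deriv ^^ n) ?\<phi> 0 = poly (Q n) 1" for n
    unfolding Q_def
    using higher_deriv_autonomous[where S = "ball 0 1" and z = 0, OF open_ball deriv_csqrt_one_plus_tanh]
    by simp
  have 0: "Q 0 = [:0, 1:]" and Suc: "Q (Suc n) = pderiv (Q n) * [:0, 1, 0, - 1 / 2:]" for n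
    by (simp_all add: Q_def)
  have 1: "Q 1 = [:0, 1, 0, - 1 / 2:]"
    using Suc[of 0] by (simp add: 0 pderiv_pCons)
  have 2: "Q 2 = [:0, 1, 0, - 2, 0, 3 / 4:]"
    using Suc[of 1] by (simp add: 1[unfolded One_nat_def] pderiv_pCons numeral_2_eq_2)
  have 3: "Q 3 = [:0, 1, 0, - 13 / 2, 0, 27 / 4, 0, - 15 / 8:]"
    using Suc[of 2] by (simp add: 2 pderiv_pCons)
  have 4: "Q 4 = [:0, 1, 0, - 20, 0, 87 / 2, 0, - 30, 0, 105 / 16:]"
    using Suc[of 3] by (simp add: 3 pderiv_pCons)
  have 5: "Q 5 = [:0, 1, 0, - 121 / 2, 0, 495 / 2, 0, - 1275 / 4, 0, 2625 / 16, 0, - 945 / 32:]"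
    using Suc[of 4] by (simp add: 4 pderiv_pCons)
  have 6: "Q 6 = [:0, 1, 0, - 182, 0, 5313 / 4, 0, - 2850, 0, 41475 / 16, 0, - 8505 / 8, 0, 10395 / 64:]"
    using Suc[of 5] by (simp add: 5 pderiv_pCons)
  have c: "taylor_coeff ?\<phi> 0 = 1" "taylor_coeff ?\<phi> 1 = 1 / 2" "taylor_coeff ?\<phi> 2 = - 1 / 8"
    "taylor_coeff ?\<phi> 3 = - 5 / 48" "taylor_coeff ?\<phi> 4 = 17 / 384"
    "taylor_coeff ?\<phi> 5 = 121 / 3840" "taylor_coeff ?\<phi> 6 = - 721 / 46080"
    unfolding taylor_coeff_def d 0 1 2 3 4 5 6 by (simp_all add: fact_numeral)
  show ?thesis
    by (simp add: lessThan_nat_numeral c c(2)[unfolded One_nat_def] norm_divide power_divide)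
qed

section \<open>Coefficient recurrence from the logarithmic derivative\<close>

lemma fps_expansion_log_deriv_quot:
  assumes f: "f holomorphic_on ball 0 1" "\<And>z. z \<in> ball 0 1 - {0} \<Longrightarrow> f z \<noteq> 0" "f 0 = 0"
    and h: "log_deriv_quot f holomorphic_on ball 0 1"
  shows "fps_X * fps_deriv (fps_expansion f 0) = fps_expansion f 0 * fps_expansion (log_deriv_quot f) 0"
proof -
  have "(\<lambda>z. f z * log_deriv_quot f z) has_fps_expansion
      fps_expansion f 0 * fps_expansion (log_deriv_quot f) 0"
    by (intro fps_expansion_intros has_fps_expansion_ball f h)
  moreover have "\<forall>\<^sub>F z in nhds 0. f z * log_deriv_quot f z = z * deriv f z"
  proof (rule eventually_nhds_in_open[of "ball 0 1", THEN eventually_mono])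
    show "f z * log_deriv_quot f z = z * deriv f z" if "z \<in> ball 0 1" for z
      using f that by (auto simp: log_deriv_quot_def)
  qed auto
  ultimately have "(\<lambda>z. z * deriv f z) has_fps_expansion
      fps_expansion f 0 * fps_expansion (log_deriv_quot f) 0"
    by (subst (asm) has_fps_expansion_cong) auto
  moreover have "(\<lambda>z. z * deriv f z) has_fps_expansion fps_X * fps_deriv (fps_expansion f 0)"
    by (intro fps_expansion_intros has_fps_expansion_ball f)
  ultimately show ?thesis
    by (metis fps_expansion_eqI)
qed

text \<open>Comparison of coefficients of z^(n+1): the constant term 1 of the quotient lowers the
  factor n+1 to n, and the last term of the convolution vanishes because
  \<open>f 0 = 0\<close>.\<close>

lemma taylor_coeff_log_deriv_quot:
  assumes f: "f holomorphic_on ball 0 1" "\<And>z. z \<in> ball 0 1 - {0} \<Longrightarrow> f z \<noteq> 0" "f 0 = 0"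
    and h: "log_deriv_quot f holomorphic_on ball 0 1"
  shows "of_nat n * taylor_coeff f (Suc n) =
    (\<Sum>i<n. taylor_coeff (log_deriv_quot f) (Suc i) * taylor_coeff f (n - i))"
proof -
  let ?F = "fps_expansion f 0" and ?H = "fps_expansion (log_deriv_quot f) 0"
  have F0: "fps_nth ?F 0 = 0" and H0: "fps_nth ?H 0 = 1"
    using f by (simp_all add: fps_expansion_def log_deriv_quot_def)
  have "fps_nth (fps_X * fps_deriv ?F) (Suc n) = fps_nth (?H * ?F) (Suc n)"
    by (simp only: fps_expansion_log_deriv_quot[OF assms] mult.commute)
  moreover have "fps_nth (fps_X * fps_deriv ?F) (Suc n) = of_nat (Suc n) * fps_nth ?F (Suc n)"
    by simp
  ultimately have "of_nat (Suc n) * fps_nth ?F (Suc n) = fps_nth (?H * ?F) (Suc n)"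
    by (simp only:)
  also have "\<dots> = (\<Sum>i<Suc (Suc n). fps_nth ?H i * fps_nth ?F (Suc n - i))"
    by (simp only: fps_mult_nth atLeast0AtMost lessThan_Suc_atMost)
  also have "\<dots> = fps_nth ?F (Suc n) + (\<Sum>i<n. fps_nth ?H (Suc i) * fps_nth ?F (n - i))"
    by (subst sum.lessThan_Suc_shift) (simp add: F0 H0)
  finally show ?thesis
    by (simp add: taylor_coeff_eq_fps_nth algebra_simps)
qed

section \<open>Expansion and estimation of determinants\<close>

text \<open>The shape of a 3x3 determinant expanded along a row with entries \<open>a\<close>,
  \<open>b\<close>, \<open>c\<close> and minors \<open>p\<close>, \<open>q\<close>,
  \<open>s\<close>.\<close>

lemma norm_laplace3_le:
  fixes a b c p q s :: "'a::real_normed_field"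
  assumes "norm a \<le> A" "norm b \<le> B" "norm c \<le> C" "norm p \<le> P" "norm q \<le> Q" "norm s \<le> S"
  shows "norm (a * p - b * q + c * s) \<le> A * P + B * Q + C * S"
proof -
  have "norm (a * p) \<le> A * P" "norm (b * q) \<le> B * Q" "norm (c * s) \<le> C * S"
    using assms by (auto simp: norm_mult intro!: mult_mono order_trans[OF norm_ge_zero])
  then show ?thesis
    by (meson add_mono norm_triangle_ineq norm_triangle_ineq4 order_trans)
qed

text \<open>Expansion along row 0, with the minors again given by index functions so that the rule
  can be iterated; the conditional skips column \<open>j\<close>.\<close>

lemma det_mat_Suc:
  fixes a :: "nat \<Rightarrow> nat \<Rightarrow> 'a::comm_ring_1"
  shows "Determinant.det (Matrix.mat (Suc n) (Suc n) (\<lambda>(i, j). a i j)) =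
    (\<Sum>j<Suc n. a 0 j * ((-1) ^ j *
      Determinant.det (Matrix.mat n n (\<lambda>(i, k). a (Suc i) (if k < j then k else Suc k)))))"
proof -
  have "mat_delete (Matrix.mat (Suc n) (Suc n) (\<lambda>(i, j). a i j)) 0 j =
      Matrix.mat n n (\<lambda>(i, k). a (Suc i) (if k < j then k else Suc k))" for j
    by (rule eq_matI) (auto simp: mat_delete_def)
  then show ?thesis
    by (subst laplace_expansion_row[where i = 0 and n = "Suc n"])
       (auto simp: Determinant.cofactor_def)
qed

text \<open>\<open>m p q s\<close> is the minor of rows 1, 2, 3 and columns \<open>p\<close>,
  \<open>q\<close>, \<open>s\<close>, itself expanded along row 1.\<close>

lemma det_mat_4:
  fixes a :: "nat \<Rightarrow> nat \<Rightarrow> 'a::comm_ring_1"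
  defines "m \<equiv> \<lambda>p q s. a 1 p * (a 2 q * a 3 s - a 2 s * a 3 q) - a 1 q * (a 2 p * a 3 s - a 2 s * a 3 p)
    + a 1 s * (a 2 p * a 3 q - a 2 q * a 3 p)"
  shows "Determinant.det (Matrix.mat 4 4 (\<lambda>(i, j). a i j)) =
    a 0 0 * m 1 2 3 - a 0 1 * m 0 2 3 + a 0 2 * m 0 1 3 - a 0 3 * m 0 1 2"
proof -
  have 4: "4 = Suc (Suc (Suc (Suc 0)))" by simp
  show ?thesis
    unfolding 4 m_def
    by (simp only: det_mat_Suc sum.lessThan_Suc)
       (simp add: numeral_2_eq_2 numeral_3_eq_3, simp add: algebra_simps)
qed

section \<open>Coefficient bounds and the estimate of the Hankel determinant\<close>

theorem theorem2p9:
  fixes f :: "complex \<Rightarrow> complex"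
  assumes "f \<in> class_S_star_B"
  shows "norm (hankel_det 4 1 f) \<le> 0.169251"
proof -
  let ?\<phi> = "\<lambda>z::complex. csqrt (1 + tanh z)"
  define h where "h = log_deriv_quot f"
  define a where "a = taylor_coeff f"
  have f: "f holomorphic_on ball 0 1" "\<And>z. z \<in> ball 0 1 - {0} \<Longrightarrow> f z \<noteq> 0" "f 0 = 0" "deriv f 0 = 1"
    and sub: "subordinate h ?\<phi>"
    using assms by (auto simp: class_S_star_B_def class_A_def h_def)
  have h: "h holomorphic_on ball 0 1"
    using sub by (simp add: subordinate_def)
  obtain w where w: "w holomorphic_on ball 0 1" "w 0 = 0" "\<And>z. norm z < 1 \<Longrightarrow> norm (w z) \<le> norm z"
    and hw: "\<And>z. z \<in> ball 0 1 \<Longrightarrow> h z = ?\<phi> (w z)"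
    using sub unfolding subordinate_def by auto
  \<comment> \<open>The two functions are known to agree on the disk only, but agreement near 0
    determines the coefficients.\<close>
  have coeff_h: "taylor_coeff h k = taylor_coeff (\<lambda>z. ?\<phi> (w z)) k" for k
  proof -
    have "\<forall>\<^sub>F z in nhds 0. h z = ?\<phi> (w z)"
      by (rule eventually_mono[OF eventually_nhds_in_open[of "ball 0 1"]]) (auto intro: hw)
    from has_fps_expansion_cong[OF this refl] have "(\<lambda>z. ?\<phi> (w z)) has_fps_expansion fps_expansion h 0"
      using has_fps_expansion_ball[OF h] by (rule iffD1)
    then show ?thesis
      by (metis taylor_coeff_eqI taylor_coeff_eq_fps_nth)
  qed
  have "(\<Sum>k<7. (norm (taylor_coeff h k))\<^sup>2) \<le> 1 + 7 / 25"
    unfolding coeff_h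
    using Rogosinski[OF holomorphic_csqrt_one_plus_tanh w] sum_norm_taylor_coeff_csqrt_one_plus_tanh
    by (rule order_trans)
  moreover have "(\<Sum>k<7. (norm (taylor_coeff h k))\<^sup>2) =
      (norm (taylor_coeff h 0))\<^sup>2 + (\<Sum>k<6. (norm (taylor_coeff h (Suc k)))\<^sup>2)"
    using sum.lessThan_Suc_shift[of _ 6] by simp
  \<comment> \<open>The constant term accounts for the 1 in \<open>1 + 7 / 25\<close>.\<close>
  moreover have "taylor_coeff h 0 = 1"
    by (simp add: taylor_coeff_def h_def log_deriv_quot_def)
  ultimately have sum_h: "(\<Sum>k<6. (norm (taylor_coeff h (Suc k)))\<^sup>2) \<le> 7 / 25"
    by simp

  \<comment> \<open>Cauchy-Schwarz separates the coefficients of \<open>h\<close> and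
    \<open>f\<close> in the recurrence; \<open>n \<le> 6\<close> stays within the six coefficients
    covered by \<open>sum_h\<close>.\<close>
  have growth: "(real n)\<^sup>2 * (norm (a (Suc n)))\<^sup>2 \<le> 7 / 25 * (\<Sum>i<n. (norm (a (Suc i)))\<^sup>2)"
    if "n \<le> 6" for n
  proof -
    have "real n * norm (a (Suc n)) = norm (\<Sum>i<n. taylor_coeff h (Suc i) * a (n - i))"
      unfolding a_def h_def
      using taylor_coeff_log_deriv_quot[OF f(1-3) h[unfolded h_def], of n]
      by (metis norm_mult norm_of_nat)
    also have "\<dots> \<le> (\<Sum>i<n. norm (taylor_coeff h (Suc i)) * norm (a (n - i)))"
      by (rule order_trans[OF norm_sum]) (simp add: norm_mult)
    finally have "(real n * norm (a (Suc n)))\<^sup>2 \<le>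
        (\<Sum>i<n. norm (taylor_coeff h (Suc i)) * norm (a (n - i)))\<^sup>2"
      by (intro power_mono) auto
    also have "\<dots> \<le> (\<Sum>i<n. (norm (taylor_coeff h (Suc i)))\<^sup>2) * (\<Sum>i<n. (norm (a (n - i)))\<^sup>2)"
      by (rule Cauchy_Schwarz_ineq_sum)
    also have "(\<Sum>i<n. (norm (a (n - i)))\<^sup>2) = (\<Sum>i<n. (norm (a (Suc i)))\<^sup>2)"
      by (subst sum.nat_diff_reindex[symmetric]) (auto intro!: sum.cong simp: Suc_diff_Suc)
    also have "(\<Sum>i<n. (norm (taylor_coeff h (Suc i)))\<^sup>2) \<le> (\<Sum>i<6. (norm (taylor_coeff h (Suc i)))\<^sup>2)"
      using that by (intro sum_mono2) auto
    also note sum_h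
    finally show ?thesis
      by (simp add: power_mult_distrib sum_nonneg mult_right_mono)
  qed
  have a1: "a 1 = 1"
    by (simp add: a_def taylor_coeff_def f)
  have bnd: "norm (a 2) \<le> 53 / 100" "norm (a 3) \<le> 3 / 10" "norm (a 4) \<le> 21 / 100"
    "norm (a 5) \<le> 4 / 25" "norm (a 6) \<le> 13 / 100" "norm (a 7) \<le> 11 / 100"
  proof -
    \<comment> \<open>The inequalities \<open>growth\<close> are linear in the squared norms and
      yield the bounds successively from \<open>a 1 = 1\<close>; the square roots are rounded up to
      hundredths.\<close>
    have *: "(norm (a 2))\<^sup>2 \<le> (53 / 100)\<^sup>2 \<and> (norm (a 3))\<^sup>2 \<le> (3 / 10)\<^sup>2 \<and> (norm (a 4))\<^sup>2 \<le> (21 / 100)\<^sup>2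
      \<and> (norm (a 5))\<^sup>2 \<le> (4 / 25)\<^sup>2 \<and> (norm (a 6))\<^sup>2 \<le> (13 / 100)\<^sup>2 \<and> (norm (a 7))\<^sup>2 \<le> (11 / 100)\<^sup>2"
      using growth[of 1] growth[of 2] growth[of 3] growth[of 4] growth[of 5] growth[of 6] a1
      by (simp add: lessThan_nat_numeral numeral_2_eq_2[symmetric] power_divide)
    then show "norm (a 2) \<le> 53 / 100" "norm (a 3) \<le> 3 / 10" "norm (a 4) \<le> 21 / 100"
      "norm (a 5) \<le> 4 / 25" "norm (a 6) \<le> 13 / 100" "norm (a 7) \<le> 11 / 100"
      by (auto intro: power2_le_imp_le)
  qed
  \<comment> \<open>A 2x2 minor is the case of \<open>norm_laplace3_le\<close> with third product
    0.\<close>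
  have minor: "norm (x * y - z * v) \<le> X * Y + Z * V"
    if "norm x \<le> X" "norm y \<le> Y" "norm z \<le> Z" "norm v \<le> V" for x y z v :: complex and X Y Z V
    using norm_laplace3_le[OF that(1,3) _ that(2,4), of 0 0 0 0] by simp
  have H: "hankel_det 4 1 f =
      1 * (a 3 * (a 5 * a 7 - a 6 * a 6) - a 4 * (a 4 * a 7 - a 6 * a 5) + a 5 * (a 4 * a 6 - a 5 * a 5)) -
      a 2 * (a 2 * (a 5 * a 7 - a 6 * a 6) - a 4 * (a 3 * a 7 - a 6 * a 4) + a 5 * (a 3 * a 6 - a 5 * a 4)) +
      a 3 * (a 2 * (a 4 * a 7 - a 6 * a 5) - a 3 * (a 3 * a 7 - a 6 * a 4) + a 5 * (a 3 * a 5 - a 4 * a 4)) -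
      a 4 * (a 2 * (a 4 * a 6 - a 5 * a 5) - a 3 * (a 3 * a 6 - a 5 * a 4) + a 4 * (a 3 * a 5 - a 4 * a 4))"
    (is "_ = 1 * ?A - _ * ?B + _ * ?C - _ * ?D")
    using a1 unfolding hankel_det_def det_mat_4 a_def by (simp add: numeral_2_eq_2[symmetric])
  \<comment> \<open>The bounds on the four 3x3 minors leave slack: inserting \<open>bnd\<close>
    gives about 0.0280, 0.0426, 0.0561 and 0.0692.\<close>
  have A: "norm ?A \<le> 1 / 25"
    using norm_laplace3_le[OF bnd(2) bnd(3) bnd(4)
      minor[OF bnd(4) bnd(6) bnd(5) bnd(5)] minor[OF bnd(3) bnd(6) bnd(5) bnd(4)]
      minor[OF bnd(3) bnd(5) bnd(4) bnd(4)]]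
    by (rule order_trans) simp
  have B: "norm ?B \<le> 1 / 16"
    using norm_laplace3_le[OF bnd(1) bnd(3) bnd(4)
      minor[OF bnd(4) bnd(6) bnd(5) bnd(5)] minor[OF bnd(2) bnd(6) bnd(5) bnd(3)]
      minor[OF bnd(2) bnd(5) bnd(4) bnd(3)]]
    by (rule order_trans) simp
  have C: "norm ?C \<le> 3 / 40"
    using norm_laplace3_le[OF bnd(1) bnd(2) bnd(4)
      minor[OF bnd(3) bnd(6) bnd(5) bnd(4)] minor[OF bnd(2) bnd(6) bnd(5) bnd(3)]
      minor[OF bnd(2) bnd(4) bnd(3) bnd(3)]]
    by (rule order_trans) simp
  have D: "norm ?D \<le> 1 / 10"
    using norm_laplace3_le[OF bnd(1) bnd(2) bnd(3)
      minor[OF bnd(3) bnd(5) bnd(4) bnd(4)] minor[OF bnd(2) bnd(5) bnd(4) bnd(3)]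
      minor[OF bnd(2) bnd(4) bnd(3) bnd(3)]]
    by (rule order_trans) simp
  \<comment> \<open>Three of the four terms fit \<open>norm_laplace3_le\<close>; with the fourth,
    bounded separately, the total is 0.116625.\<close>
  have "norm (1 * ?A - a 2 * ?B + a 3 * ?C) \<le> 1 * (1 / 25) + 53 / 100 * (1 / 16) + 3 / 10 * (3 / 40)"
    by (rule norm_laplace3_le[OF _ bnd(1) bnd(2) A B C]) simp
  moreover have "norm (a 4 * ?D) \<le> 21 / 100 * (1 / 10)"
    unfolding norm_mult by (intro mult_mono bnd D) auto
  ultimately show ?thesis
    unfolding H by (intro order_trans[OF norm_triangle_ineq4]) simp
qed

end
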